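(* Let $P_n(x)=\frac{x^n-1}{x-1}$ for $n\geq 1$ and fix an integer $h\geq 1$. Then $\lim_{n\to\infty}m_{2h+1}(P_n)=0$. Moreover, the sequence $(m_{2h+1}(P_n))_{n\geq1}$ is not constant.
   Context: For a nonzero $P\in\mathbb{C}[x]$ and integer $k\geq1$, $m_k(P)=\int_0^1\log^k|P(e^{2\pi i\theta})|\,d\theta$. *)

theory Defs
  imports "HOL-Analysis.Analysis" "HOL-Computational_Algebra.Polynomial"
begin

text \<open>
  The integrand is modified only on a null set by the convention \<^term>\<open>ln 0 = (0::real)\<close>:
  a nonzero polynomial has finitely many zeros on the unit circle.
\<close>

definition mahler_k :: "nat \<Rightarrow> complex poly \<Rightarrow> real" where
  "mahler_k k P =
     (LINT \<theta>:{0..1}|lborel. (ln (cmod (poly P (exp (2 * of_real pi * \<i> * of_real \<theta>))))) ^ k)"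

definition P_poly :: "nat \<Rightarrow> complex poly" where
  "P_poly n = (monom 1 n - 1) div (monom 1 1 - 1)"

text \<open>The polynomial division in the definition of \<^const>\<open>P_poly\<close> is exact.\<close>

lemma P_poly_mult: "P_poly n * (monom 1 1 - 1) = monom 1 n - 1"
proof -
  have "(monom 1 1 - 1 :: complex poly) dvd (monom 1 1) ^ n - 1"
    by (simp only: power_diff_1_eq dvd_triv_left)
  then have "(monom 1 1 - 1 :: complex poly) dvd monom 1 n - 1"
    by (simp add: monom_power)
  then show ?thesis
    by (simp add: P_poly_def)
qed

end

theory Submission
  imports Defs
begin

text \<open>
  On the unit circle \<open>ln \<bar>P\<^sub>n\<bar>\<close> is \<open>f (n x) - f x\<close> with \<open>f x = ln \<bar>2 sin (\<pi> x)\<bar>\<close>. As \<open>n\<close> grows,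
  \<open>f (n x)\<close> and \<open>f x\<close> become independent and identically distributed, so odd moments of the
  difference tend to \<open>0\<close>. For continuous periodic functions this is Fejer's averaging argument;
  \<open>f\<close> is reduced to that case by truncation at \<open>- N\<close>, with an error that is \<open>O(1/N)\<close> uniformly
  in \<open>n\<close> because all moments of \<open>f\<close> are finite. The sequence is not constant because it is \<open>0\<close> at
  \<open>n = 1\<close> and negative at \<open>n = 2\<close>.
\<close>

definition log_two_sin :: "real \<Rightarrow> real" where
  "log_two_sin x = ln \<bar>2 * sin (pi * x)\<bar>"

lemma sin_pi_add_int: "\<bar>sin (pi * (x + of_int k))\<bar> = \<bar>sin (pi * x)\<bar>"
  by (simp add: distrib_left sin_add cos_npi_int abs_mult)

section \<open>Integrals of periodic functions and Fejer averaging\<close>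

text \<open>The substitution \<open>n * x - k\<close> carries the piece onto one full period, and
  periodicity absorbs the shift by \<open>k\<close>.\<close>

lemma has_integral_periodic_piece:
  fixes g :: "real \<Rightarrow> real"
  assumes per: "\<And>x k. g (x + of_int k) = g x"
    and g: "(g has_integral I) {0..1}" and n: "n \<ge> 1"
  shows "((\<lambda>x. g (real n * x)) has_integral I / n) {real k / n .. real (Suc k) / n}"
proof -
  have "((\<lambda>x. g (real n *\<^sub>R x + (- real k))) has_integral (I /\<^sub>R real n ^ DIM(real)))
           (cbox ((0 - (- real k)) /\<^sub>R real n) ((1 - (- real k)) /\<^sub>R real n))"
    using g n by (intro has_integral_affinity') auto
  moreover have "g (real n * x - real k) = g (real n * x)" for x
    using per[of "real n * x" "- int k"] by simp
  ultimately show ?thesis by (simp add: field_simps)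
qed

lemma has_integral_periodic_scale:
  fixes g :: "real \<Rightarrow> real"
  assumes per: "\<And>x k. g (x + of_int k) = g x"
    and g: "(g has_integral I) {0..1}" and n: "n \<ge> 1"
  shows "((\<lambda>x. g (real n * x)) has_integral I) {0..1}"
proof -
  have "((\<lambda>x. g (real n * x)) has_integral (real m * (I / n))) {0 .. real m / n}" for m
  proof (induction m)
    case 0
    show ?case using has_integral_refl(2)[of _ "0::real"] by simp
  next
    case (Suc m)
    have "((\<lambda>x. g (real n * x)) has_integral (real m * (I / n) + I / n)) {0 .. real (Suc m) / n}"
      using n by (intro has_integral_combine[OF _ _ Suc has_integral_periodic_piece[OF per g n]])
        (auto simp: field_simps)
    then show ?case by (simp add: algebra_simps add_divide_distrib)
  qed
  from this[of n] show ?thesis using n by simp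
qed

text \<open>Swapping the order of integration turns the double integral into its own
  negative.\<close>

lemma integral_antisymmetric_continuous:
  fixes H :: "real \<Rightarrow> real \<Rightarrow> real"
  assumes cont: "continuous_on ({0..1} \<times> {0..1}) (\<lambda>(x, y). H x y)"
    and anti: "\<And>x y. H x y = - H y x"
  shows "integral {0..1} (\<lambda>y. integral {0..1} (\<lambda>x. H x y)) = 0"
proof -
  have "integral {0..1} (\<lambda>y. integral {0..1} (\<lambda>x. H x y))
      = integral {0..1} (\<lambda>x. integral {0..1} (\<lambda>y. H x y))"
    using integral_swap_continuous[of 0 0 1 1 H] cont by (simp add: cbox_Pair_eq)
  also have "\<dots> = integral {0..1} (\<lambda>x. - integral {0..1} (\<lambda>y. H y x))"
    by (subst anti) simp
  also have "\<dots> = - integral {0..1} (\<lambda>x. integral {0..1} (\<lambda>y. H y x))"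
    by simp
  finally show ?thesis by simp
qed

text \<open>On an interval of length \<open>1/n\<close> the second argument is almost
  constant while the first runs over a full period.\<close>

lemma integral_diagonal_tendsto_0:
  fixes H :: "real \<Rightarrow> real \<Rightarrow> real"
  assumes cont: "continuous_on UNIV (\<lambda>(x, y). H x y)"
    and per: "\<And>x y k. H (x + of_int k) y = H x y"
    and anti: "\<And>x y. H x y = - H y x"
  shows "(\<lambda>n. integral {0..1} (\<lambda>x. H (real n * x) x)) \<longlonglongrightarrow> 0"
proof (rule LIMSEQ_I)
  fix r :: real assume r: "r > 0"
  \<comment> \<open>The \<open>n\<close> pieces below contribute at most
    \<open>2 * e = r / 2\<close> in total.\<close>
  define e where "e = r / 4"
  have e: "e > 0" using r by (simp add: e_def)
  \<comment> \<open>\<open>B y\<close> is the mean of \<open>H\<close> over a period of the first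
    argument, with the second frozen at \<open>y\<close>.\<close>
  define B where "B = (\<lambda>y. integral {0..1} (\<lambda>x. H x y))"
  have contc: "continuous_on S (\<lambda>x. H (f x) (g x))"
    if "continuous_on S f" "continuous_on S g" for S :: "real set" and f g
  proof -
    have "continuous_on S (\<lambda>x. (\<lambda>(x, y). H x y) (f x, g x))"
      by (rule continuous_on_compose2[OF cont]) (use that in \<open>auto intro!: continuous_intros\<close>)
    then show ?thesis by simp
  qed
  have "uniformly_continuous_on ({0..1} \<times> {0..1}) (\<lambda>(x, y). H x y)"
    by (intro compact_uniformly_continuous compact_Times continuous_on_subset[OF cont]) auto
  then obtain d where d: "d > 0" and
    dH: "\<And>p q. p \<in> {0..1} \<times> {0..1} \<Longrightarrow> q \<in> {0..1} \<times> {0..1} \<Longrightarrow> dist q p < d \<Longrightarrow>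
       dist ((\<lambda>(x, y). H x y) q) ((\<lambda>(x, y). H x y) p) < e"
    unfolding uniformly_continuous_on_def using e by metis
  \<comment> \<open>Uniform continuity is known on the unit square only; \<open>frac\<close> brings
    the first argument into it, for arbitrary real \<open>x\<close>.\<close>
  have Hclose: "\<bar>H x y - H x z\<bar> \<le> e" if "y \<in> {0..1}" "z \<in> {0..1}" "\<bar>y - z\<bar> < d" for x y z
  proof -
    have "H x w = H (frac x) w" for w
      using per[of "frac x" "\<lfloor>x\<rfloor>" w] by (simp add: frac_def)
    moreover have "\<bar>H (frac x) y - H (frac x) z\<bar> < e"
      using dH[of "(frac x, z)" "(frac x, y)"] that
      by (auto simp: dist_Pair_Pair dist_real_def frac_lt_1 less_imp_le)
    ultimately show ?thesis by simp
  qed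
  have Hint: "(\<lambda>x. H x y) integrable_on {0..1}" for y
    by (intro integrable_continuous_real contc continuous_intros)
  have Bclose: "\<bar>B y - B z\<bar> \<le> e" if "y \<in> {0..1}" "z \<in> {0..1}" "\<bar>y - z\<bar> < d" for y z
  proof -
    have "B y - B z = integral {0..1} (\<lambda>x. H x y - H x z)"
      unfolding B_def by (rule integral_diff[symmetric]) (rule Hint)+
    moreover have "norm (integral {0..1} (\<lambda>x. H x y - H x z)) \<le> e * (1 - 0)"
      by (intro integral_bound continuous_intros contc) (use Hclose[OF that] in auto)
    ultimately show ?thesis by simp
  qed
  have contB: "continuous_on {0..1} B"
  proof -
    have "continuous_on ({0..1} \<times> cbox 0 1) (\<lambda>p. (\<lambda>(x, y). H x y) (snd p, fst p))"
      by (rule continuous_on_compose2[OF cont]) (auto intro!: continuous_intros)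
    then have "continuous_on {0..1} (\<lambda>y. integral (cbox 0 1) (\<lambda>x. H x y))"
      by (intro integral_continuous_on_param) (simp add: case_prod_unfold)
    then show ?thesis by (simp add: B_def)
  qed
  have B0: "integral {0..1} B = 0"
    unfolding B_def
    by (intro integral_antisymmetric_continuous anti continuous_on_subset[OF cont]) auto
  obtain n0 where n0: "real n0 > 1 / d" using reals_Archimedean2 by blast
  have "norm (integral {0..1} (\<lambda>x. H (real n * x) x) - 0) < r" if nn: "n \<ge> Suc n0" for n
  proof -
    have n: "n \<ge> 1" using nn by simp
    have "1 / d < real n" using n0 nn by linarith
    then have nd: "1 / real n < d" using d n by (simp add: field_simps)
    define D where "D = (\<lambda>x. H (real n * x) x - B x)"
    have Dint: "D integrable_on {a..b}" if "0 \<le> a" "b \<le> 1" for a b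
      unfolding D_def
      by (intro integrable_continuous_real continuous_intros contc continuous_on_subset[OF contB])
        (use that in auto)
    have piece: "\<bar>integral {real k / n .. real (Suc k) / n} D\<bar> \<le> 2 * e / n" if k: "Suc k \<le> n" for k
    proof -
      let ?I = "{real k / n .. real (Suc k) / n}" and ?c = "real k / n"
      have sub: "?I \<subseteq> {0..1}" using k n by (auto simp: field_simps)
      have len: "real (Suc k) / n - real k / n = 1 / n" by (simp add: diff_divide_distrib[symmetric])
      have cI: "?c \<in> ?I" using n by (simp add: field_simps)
      \<comment> \<open>With the second argument frozen at \<open>?c\<close>, the function
        \<open>H (real n * x) ?c\<close> runs through one period on \<open>?I\<close>, so it has the
        same integral there as the constant \<open>B ?c\<close>. Subtracting their difference from
        \<open>D\<close> keeps the integral and leaves an integrand of size at most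
        \<open>2 * e\<close>: one \<open>e\<close> from \<open>H\<close>, one from
        \<open>B\<close>.\<close>
      have h1: "((\<lambda>x. H (real n * x) ?c) has_integral B ?c / n) ?I"
        unfolding B_def
        by (rule has_integral_periodic_piece[OF per _ n]) (use Hint in \<open>auto simp: has_integral_integral\<close>)
      have h2: "((\<lambda>x. B ?c) has_integral B ?c / n) ?I"
        using has_integral_const_real[of "B ?c" "real k / n" "real (Suc k) / n"] len cI by simp
      have h3: "(D has_integral integral ?I D) ?I"
        using Dint[of "real k / n" "real (Suc k) / n"] sub cI by (auto simp: has_integral_integral)
      have "((\<lambda>x. D x - (H (real n * x) ?c - B ?c)) has_integral integral ?I D - (B ?c / n - B ?c / n)) ?I"
        by (intro has_integral_diff h1 h2 h3)
      then have h4: "((\<lambda>x. D x - (H (real n * x) ?c - B ?c)) has_integral integral ?I D) (cbox ?c (real (Suc k) / n))"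
        by simp
      have "norm (integral ?I D) \<le> 2 * e * measure lborel (cbox ?c (real (Suc k) / n))"
      proof (rule has_integral_bound[OF _ h4])
        show "0 \<le> 2 * e" using e by simp
        fix x assume x: "x \<in> cbox ?c (real (Suc k) / n)"
        then have "x \<in> ?I" by (simp only: cbox_interval)
        then have x1: "x \<in> {0..1}" "?c \<in> {0..1}" using sub cI by blast+
        have x2: "\<bar>x - ?c\<bar> < d" using x nd len by auto
        show "norm (D x - (H (real n * x) ?c - B ?c)) \<le> 2 * e"
          using Hclose[OF x1 x2, of "real n * x"] Bclose[OF x1 x2] by (simp add: D_def)
      qed
      then show ?thesis using len cI by simp
    qed
    have "\<bar>integral {0 .. real m / n} D\<bar> \<le> real m * (2 * e / n)" if "m \<le> n" for m
      using that
    proof (induction m)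
      case 0
      then show ?case by simp
    next
      case (Suc m)
      have "integral {0 .. real (Suc m) / n} D =
          integral {0 .. real m / n} D + integral {real m / n .. real (Suc m) / n} D"
        using Suc.prems n
        by (intro Henstock_Kurzweil_Integration.integral_combine[symmetric] Dint) (auto simp: field_simps)
      then show ?case using piece[OF Suc.prems] Suc
        by (simp add: algebra_simps add_divide_distrib)
    qed
    from this[of n] n have "\<bar>integral {0..1} D\<bar> \<le> 2 * e" by simp
    moreover have "integral {0..1} D = integral {0..1} (\<lambda>x. H (real n * x) x) - integral {0..1} B"
      unfolding D_def
      by (intro integral_diff integrable_continuous_real continuous_intros contc contB)
    ultimately show ?thesis using B0 r by (simp add: e_def)
  qed
  then show "\<exists>no. \<forall>n\<ge>no. norm (integral {0..1} (\<lambda>x. H (real n * x) x) - 0) < r" by blast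
qed


section \<open>Finiteness of the moments of \<open>log_two_sin\<close>\<close>

lemma log_two_sin_add_int: "log_two_sin (x + of_int k) = log_two_sin x"
  by (simp add: log_two_sin_def abs_mult sin_pi_add_int)

lemma log_two_sin_measurable [measurable]: "log_two_sin \<in> borel_measurable borel"
  unfolding log_two_sin_def by measurable

text \<open>Jordan's inequality: the sine is concave on \<open>[0, pi]\<close>, so it lies above its
  chord from \<open>0\<close> to \<open>pi / 2\<close>.\<close>

lemma sin_pi_ge:
  assumes "0 \<le> x" "x \<le> 1/2"
  shows "2 * x \<le> sin (pi * x)"
proof -
  have "convex_on {0..pi} (\<lambda>t. - sin t)"
  proof (rule f''_ge0_imp_convex)
    show "((\<lambda>t. - sin t) has_real_derivative - cos t) (at t)" for t
      by (auto intro!: derivative_eq_intros)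
    show "((\<lambda>t. - cos t) has_real_derivative sin t) (at t)" for t
      by (auto intro!: derivative_eq_intros)
  qed (auto intro: sin_ge_zero)
  from convex_onD[OF this, of "2 * x" 0 "pi / 2"] assms show ?thesis
    by (simp add: mult.commute)
qed

text \<open>With \<open>t = \<bar>ln w\<bar> / 2\<close>, a single term
  \<open>t ^ k / fact k\<close> of the exponential series is at most \<open>exp t\<close>. For
  \<open>w \<le> 1\<close> this is \<open>w powr (-1/2)\<close>; for \<open>w\<close> between 1 and
  2 it is \<open>w * w powr (-1/2)\<close>, which costs a further factor 2. The exponent
  \<open>-1/2\<close> is integrable at 0.\<close>

lemma abs_ln_power_le_powr:
  fixes w :: real
  assumes "0 < w" "w \<le> 2"
  shows "\<bar>ln w\<bar> ^ k \<le> fact k * 2 ^ Suc k * w powr (- 1/2)"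
proof -
  let ?t = "\<bar>ln w\<bar> / 2"
  have "(\<Sum>n\<in>{k}. ?t ^ n /\<^sub>R fact n) \<le> exp ?t"
    unfolding exp_def by (rule sum_le_suminf[OF summable_exp_generic]) auto
  then have "\<bar>ln w\<bar> ^ k \<le> fact k * 2 ^ k * exp ?t"
    by (simp add: field_simps power_divide)
  also have "exp ?t \<le> 2 * w powr (- 1/2)"
  proof (cases "ln w \<ge> 0")
    case True
    have "exp (ln w / 2) = exp (ln w) * exp (- ln w / 2)"
      by (subst exp_add[symmetric]) simp
    also have "\<dots> \<le> 2 * exp (- ln w / 2)"
      using assms by simp
    finally show ?thesis using True assms by (simp add: powr_def)
  next
    case False
    then show ?thesis using assms by (simp add: powr_def)
  qed
  finally show ?thesis by (simp add: mult_left_mono mult.assoc)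
qed

lemma log_two_sin_power_integrable:
  "(\<lambda>x. \<bar>log_two_sin x\<bar> ^ k) integrable_on {0..1}"
proof -
  define C :: real where "C = fact k * 2 ^ Suc k"
  \<comment> \<open>The two powers dominate the singularities at 0 and 1. At these end points
    \<open>ln 0 = 0\<close>, so the power there is 0, or 1 when \<open>k = 0\<close>; the summand 1
    covers this.\<close>
  define g :: "real \<Rightarrow> real" where "g = (\<lambda>x. C * (x powr (-1/2) + (1 - x) powr (-1/2)) + 1)"
  have i1: "(\<lambda>x. x powr (-1/2)) integrable_on {0..1::real}"
    by (rule integrable_on_powr_from_0) auto
  then obtain I where "((\<lambda>x. x powr (-1/2)) has_integral I) {0..1::real}"
    by (auto simp: integrable_on_def)
  then have "((\<lambda>x. (- x) powr (-1/2)) has_integral I) {-1..-0::real}"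
    by (subst has_integral_reflect_real)
  then have "((\<lambda>x. (1 - x) powr (-1/2)) has_integral I) {0..1::real}"
    using has_integral_affinity'[of "\<lambda>x. (- x) powr (-1/2)" I "-1" 0 1 "-1"] by simp
  then have "(\<lambda>x. (1 - x) powr (-1/2)) integrable_on {0..1::real}"
    by (auto simp: integrable_on_def)
  with i1 have g: "g integrable_on {0..1}"
    unfolding g_def by (intro integrable_add integrable_on_mult_right integrable_const_ivl)
  have C: "C > 0" by (simp add: C_def)
  have half: "\<bar>log_two_sin x\<bar> ^ k \<le> C * x powr (-1/2)" if "0 < x" "x \<le> 1/2" for x
  proof -
    have s: "x \<le> 2 * sin (pi * x)" using sin_pi_ge[of x] that by simp
    have "\<bar>log_two_sin x\<bar> ^ k \<le> C * (2 * sin (pi * x)) powr (-1/2)"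
      using abs_ln_power_le_powr[of "2 * sin (pi * x)" k] s that
      by (simp add: log_two_sin_def C_def)
    also have "\<dots> \<le> C * x powr (-1/2)"
      using s that C by (intro mult_left_mono powr_mono2') auto
    finally show ?thesis .
  qed
  have refl: "log_two_sin (1 - x) = log_two_sin x" for x
    by (simp add: log_two_sin_def right_diff_distrib)
  have bound: "norm (\<bar>log_two_sin x\<bar> ^ k) \<le> g x" if x: "x \<in> {0..1}" for x
  proof -
    consider "x = 0 \<or> x = 1" | "0 < x" "x \<le> 1/2" | "0 < 1 - x" "1 - x \<le> 1/2"
      using x by force
    then show ?thesis
    proof cases
      case 1
      then show ?thesis using C by (auto simp: log_two_sin_def g_def power_0_left)
    next
      case 2
      have "0 \<le> C * (1 - x) powr (-1/2)" using C by simp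
      then show ?thesis using half[OF 2] by (simp add: g_def distrib_left)
    next
      case 3
      have "0 \<le> C * x powr (-1/2)" using C by simp
      then show ?thesis using half[OF 3] by (simp add: g_def distrib_left refl)
    qed
  qed
  have meas: "(\<lambda>x. \<bar>log_two_sin x\<bar> ^ k) \<in> borel_measurable (lebesgue_on {0..1})"
    by (intro measurable_restrict_space1 measurable_completion) measurable
  show ?thesis
    by (rule measurable_bounded_by_integrable_imp_integrable[OF meas g]) (use bound in auto)
qed

text \<open>The sum is at most twice the larger term, whose power is one of the two
  summands.\<close>

lemma add_power_le:
  fixes u v :: real
  assumes "0 \<le> u" "0 \<le> v"
  shows "(u + v) ^ p \<le> 2 ^ p * (u ^ p + v ^ p)"
proof -
  have "(u + v) ^ p \<le> (2 * max u v) ^ p"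
    using assms by (intro power_mono) auto
  also have "\<dots> = 2 ^ p * max u v ^ p" by (rule power_mult_distrib)
  also have "\<dots> \<le> 2 ^ p * (u ^ p + v ^ p)"
    using assms by (intro mult_left_mono) (auto simp: max_def)
  finally show ?thesis .
qed

text \<open>The moments of \<open>log_two_sin (real n * x)\<close> do not depend on
  \<open>n\<close>; this is the source of all bounds uniform in \<open>n\<close>.\<close>

lemma log_two_sin_scaled_integral:
  assumes "n \<ge> 1"
  shows "((\<lambda>x. \<bar>log_two_sin (real n * x)\<bar> ^ k) has_integral integral {0..1} (\<lambda>x. \<bar>log_two_sin x\<bar> ^ k)) {0..1}"
  using log_two_sin_power_integrable assms
  by (intro has_integral_periodic_scale[where g = "\<lambda>x. \<bar>log_two_sin x\<bar> ^ k"])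
    (auto simp: log_two_sin_add_int has_integral_integral)

text \<open>Absolute integrability lets the gauge integral be identified with the Lebesgue integral
  in \<open>mahler_k\<close>.\<close>

lemma log_two_sin_diff_integrable:
  assumes "n \<ge> 1"
  shows "(\<lambda>x. (log_two_sin (real n * x) - log_two_sin x) ^ k) absolutely_integrable_on {0..1}"
proof (rule measurable_bounded_by_integrable_imp_absolutely_integrable)
  show "(\<lambda>x. (log_two_sin (real n * x) - log_two_sin x) ^ k) \<in> borel_measurable (lebesgue_on {0..1})"
    by (intro measurable_restrict_space1 measurable_completion) measurable
  show "(\<lambda>x. 2 ^ k * (\<bar>log_two_sin (real n * x)\<bar> ^ k + \<bar>log_two_sin x\<bar> ^ k)) integrable_on {0..1}"
    using log_two_sin_scaled_integral[OF assms, of k] log_two_sin_power_integrable[of k]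
    by (intro integrable_on_mult_right integrable_add) (auto simp: integrable_on_def)
  fix x :: real
  have "norm ((log_two_sin (real n * x) - log_two_sin x) ^ k)
      \<le> (\<bar>log_two_sin (real n * x)\<bar> + \<bar>log_two_sin x\<bar>) ^ k"
    unfolding norm_power by (intro power_mono) auto
  also have "\<dots> \<le> 2 ^ k * (\<bar>log_two_sin (real n * x)\<bar> ^ k + \<bar>log_two_sin x\<bar> ^ k)"
    by (intro add_power_le) auto
  finally show "norm ((log_two_sin (real n * x) - log_two_sin x) ^ k)
      \<le> 2 ^ k * (\<bar>log_two_sin (real n * x)\<bar> ^ k + \<bar>log_two_sin x\<bar> ^ k)" .
qed auto

section \<open>Mahler integrals of \<open>P_poly\<close> through \<open>log_two_sin\<close>\<close>

lemma sin_multiple_nonzero: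
  assumes n: "n \<ge> 1" and x: "x \<in> {0..1} - (\<lambda>i. real i / real n) ` {..n}"
  shows "sin (pi * (real n * x)) \<noteq> 0" "sin (pi * x) \<noteq> 0"
proof -
  show *: "sin (pi * (real n * x)) \<noteq> 0"
  proof
    assume "sin (pi * (real n * x)) = 0"
    then obtain i :: int where i: "real n * x = of_int i"
      by (auto simp: sin_zero_iff_int2)
    have "real n * x \<ge> 0" "real n * x \<le> real n" using x n by (auto simp: mult_left_le)
    then have "0 \<le> i" "i \<le> int n" using i by linarith+
    then have "x = real (nat i) / real n" "nat i \<le> n"
      using i n by (auto simp: field_simps)
    then show False using x by auto
  qed
  show "sin (pi * x) \<noteq> 0"
  proof
    assume "sin (pi * x) = 0"
    then obtain i :: int where "x = of_int i"
      by (auto simp: sin_zero_iff_int2)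
    then have "pi * (real n * x) = of_int (int n * i) * pi" by simp
    then show False using * sin_zero_iff_int2 by blast
  qed
qed

text \<open>Chord length on the unit circle,
  \<open>\<bar>exp (i * t) - 1\<bar> = 2 * \<bar>sin (t / 2)\<bar>\<close>, applied to both sides of
  \<open>P_poly_mult\<close>.\<close>

lemma cmod_P_poly:
  assumes "sin (pi * x) \<noteq> 0"
  shows "cmod (poly (P_poly n) (exp (2 * of_real pi * \<i> * of_real x)))
       = \<bar>2 * sin (pi * (real n * x))\<bar> / \<bar>2 * sin (pi * x)\<bar>"
proof -
  let ?z = "exp (2 * of_real pi * \<i> * of_real x)"
  have 1: "cmod (?z ^ m - 1) = \<bar>2 * sin (pi * (real m * x))\<bar>" for m
  proof -
    have "?z ^ m = exp (\<i> * of_real (2 * pi * (real m * x)))"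
      by (simp add: exp_of_nat_mult[symmetric] algebra_simps)
    then show ?thesis by (simp add: dist_exp_i_1 abs_mult del: of_real_mult)
  qed
  have "poly (P_poly n) ?z * (?z - 1) = ?z ^ n - 1"
    using arg_cong[OF P_poly_mult, of "\<lambda>p. poly p ?z"] by (simp add: poly_monom)
  then have "cmod (poly (P_poly n) ?z) * \<bar>2 * sin (pi * x)\<bar> = \<bar>2 * sin (pi * (real n * x))\<bar>"
    using 1[of 1] 1[of n] by (metis norm_mult power_one_right of_nat_1 mult_1)
  then show ?thesis using assms by (simp add: field_simps)
qed

lemma mahler_P_poly:
  assumes n: "n \<ge> 1"
  shows "mahler_k k (P_poly n) = integral {0..1} (\<lambda>x. (log_two_sin (real n * x) - log_two_sin x) ^ k)"
proof -
  let ?F = "\<lambda>x. ln (cmod (poly (P_poly n) (exp (2 * of_real pi * \<i> * of_real x)))) ^ k"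
  \<comment> \<open>\<open>?N\<close> contains every zero of either sine in \<open>[0, 1]\<close>;
    off it the logarithm of the quotient splits.\<close>
  let ?N = "(\<lambda>i. real i / real n) ` {..n}"
  have eq: "(log_two_sin (real n * x) - log_two_sin x) ^ k = ?F x" if "x \<in> {0..1} - ?N" for x
    using sin_multiple_nonzero[OF n that] cmod_P_poly[of x n]
    by (simp add: log_two_sin_def ln_div)
  have neg: "negligible ?N" by (intro negligible_finite) auto
  have F: "?F absolutely_integrable_on {0..1}"
    by (rule absolutely_integrable_spike[OF log_two_sin_diff_integrable[OF n, of k] neg])
      (use eq in auto)
  have meas: "?F \<in> borel_measurable borel"
    by (intro borel_measurable_power borel_measurable_ln borel_measurable_norm
        borel_measurable_continuous_onI continuous_intros)
  \<comment> \<open>For a Borel integrand, \<open>lborel\<close> and its completion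
    \<open>lebesgue\<close> give the same integral.\<close>
  have "mahler_k k (P_poly n) = (LINT x:{0..1}|lebesgue. ?F x)"
    unfolding mahler_k_def set_lebesgue_integral_def
    by (intro integral_completion[symmetric] borel_measurable_scaleR) (use meas in auto)
  also have "\<dots> = integral {0..1} ?F"
    using F by (rule set_lebesgue_integral_eq_integral)
  also have "\<dots> = integral {0..1} (\<lambda>x. (log_two_sin (real n * x) - log_two_sin x) ^ k)"
    by (rule integral_spike[OF neg]) (use eq in auto)
  finally show ?thesis .
qed

section \<open>Truncation and the limit of the odd moments\<close>

lemma has_integral_le_off_negligible:
  fixes f g :: "real \<Rightarrow> real"
  assumes "(f has_integral i) S" "(g has_integral j) S" "negligible N"
    and "\<And>x. x \<in> S - N \<Longrightarrow> f x \<le> g x"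
  shows "i \<le> j"
proof (rule has_integral_le)
  \<comment> \<open>Replacing \<open>f\<close> by \<open>g\<close> on \<open>N\<close> keeps its
    integral and makes the inequality hold on all of \<open>S\<close>.\<close>
  show "((\<lambda>x. if x \<in> N then g x else f x) has_integral i) S"
    using assms(1) by (rule has_integral_spike[OF assms(3), rotated]) auto
qed (use assms in auto)

text \<open>The maximum is taken inside the logarithm, so that the function is continuous at the
  zeros of the sine too, where \<open>log_two_sin\<close> has the default value 0.\<close>

definition log_two_sin_trunc :: "real \<Rightarrow> real \<Rightarrow> real" where
  "log_two_sin_trunc N x = ln (max \<bar>2 * sin (pi * x)\<bar> (exp (- N)))"

lemma log_two_sin_trunc_eq_max:
  assumes "sin (pi * x) \<noteq> 0"
  shows "log_two_sin_trunc N x = max (log_two_sin x) (- N)"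
  using assms ln_le_cancel_iff[of "\<bar>2 * sin (pi * x)\<bar>" "exp (- N)"]
  by (auto simp: log_two_sin_trunc_def log_two_sin_def max_def)

lemma log_two_sin_trunc_add_int: "log_two_sin_trunc N (x + of_int k) = log_two_sin_trunc N x"
  by (simp add: log_two_sin_trunc_def abs_mult sin_pi_add_int)

lemma continuous_on_log_two_sin_trunc:
  fixes f :: "real \<Rightarrow> real"
  assumes "continuous_on S f"
  shows "continuous_on S (\<lambda>x. log_two_sin_trunc N (f x))"
  unfolding log_two_sin_trunc_def
proof (rule continuous_on_ln)
  show "continuous_on S (\<lambda>x. max \<bar>2 * sin (pi * f x)\<bar> (exp (- N)))"
    by (intro continuous_intros assms)
  show "\<forall>x\<in>S. max \<bar>2 * sin (pi * f x)\<bar> (exp (- N)) \<noteq> 0"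
    by (metis exp_gt_zero less_irrefl less_max_iff_disj)
qed

text \<open>If neither argument is truncated, the error is 0. Otherwise
  \<open>w = \<bar>u\<bar> + \<bar>v\<bar>\<close> is at least \<open>N\<close>; both powers are at
  most \<open>w ^ k\<close>, hence at most \<open>w ^ Suc k / N\<close>, as in Markov's
  inequality.\<close>

lemma truncation_error:
  fixes u v N :: real
  assumes N: "N > 0"
  shows "\<bar>(u - v) ^ k - (max u (- N) - max v (- N)) ^ k\<bar>
       \<le> 2 ^ (k + 2) / N * (\<bar>u\<bar> ^ Suc k + \<bar>v\<bar> ^ Suc k)"
proof (cases "u \<ge> - N \<and> v \<ge> - N")
  case True
  then have "max u (- N) = u" "max v (- N) = v" by auto
  then show ?thesis using N by simp
next
  case False
  let ?w = "\<bar>u\<bar> + \<bar>v\<bar>"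
  have w: "?w \<ge> N" using False by auto
  have "\<bar>u - v\<bar> ^ k \<le> ?w ^ k" by (intro power_mono) auto
  moreover have "\<bar>max u (- N) - max v (- N)\<bar> ^ k \<le> ?w ^ k"
    using N by (intro power_mono) auto
  ultimately have "\<bar>(u - v) ^ k - (max u (- N) - max v (- N)) ^ k\<bar> \<le> 2 * ?w ^ k"
    unfolding power_abs[symmetric] by linarith
  also have "\<dots> \<le> 2 / N * ?w ^ Suc k"
    using N mult_right_mono[OF w, of "?w ^ k"] by (simp add: field_simps)
  also have "\<dots> \<le> 2 / N * (2 ^ Suc k * (\<bar>u\<bar> ^ Suc k + \<bar>v\<bar> ^ Suc k))"
    using N by (intro mult_left_mono add_power_le) auto
  finally show ?thesis by simp
qed

text \<open>\<open>truncation_error\<close> is integrated; both moments on its right equal the same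
  constant, so the bound is free of \<open>n\<close>.\<close>

lemma log_two_sin_diff_truncation:
  assumes n: "n \<ge> 1" and N: "N > 0"
  shows "\<bar>integral {0..1} (\<lambda>x. (log_two_sin (real n * x) - log_two_sin x) ^ k)
        - integral {0..1} (\<lambda>x. (log_two_sin_trunc N (real n * x) - log_two_sin_trunc N x) ^ k)\<bar>
      \<le> 2 ^ (k + 3) / N * integral {0..1} (\<lambda>x. \<bar>log_two_sin x\<bar> ^ Suc k)"
    (is "\<bar>?I - ?J\<bar> \<le> ?c * ?M")
proof -
  let ?A = "(\<lambda>i. real i / real n) ` {..n}"
  let ?f = "\<lambda>x. (log_two_sin (real n * x) - log_two_sin x) ^ k"
  let ?g = "\<lambda>x. (log_two_sin_trunc N (real n * x) - log_two_sin_trunc N x) ^ k"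
  let ?b = "\<lambda>x. 2 ^ (k + 2) / N * (\<bar>log_two_sin (real n * x)\<bar> ^ Suc k + \<bar>log_two_sin x\<bar> ^ Suc k)"
  have neg: "negligible ?A" by (intro negligible_finite) auto
  have f: "(?f has_integral ?I) {0..1}"
    using set_lebesgue_integral_eq_integral(1)[OF log_two_sin_diff_integrable[OF n]]
    by (simp add: has_integral_integral)
  have g: "(?g has_integral ?J) {0..1}"
    by (intro integrable_integral integrable_continuous_real continuous_intros
        continuous_on_log_two_sin_trunc)
  have "(?b has_integral 2 ^ (k + 2) / N * (?M + ?M)) {0..1}"
    by (intro has_integral_mult_right has_integral_add log_two_sin_scaled_integral n
        integrable_integral log_two_sin_power_integrable)
  moreover have "2 ^ (k + 2) / N * (?M + ?M) = ?c * ?M"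
    by (simp add: power_add)
  ultimately have b: "(?b has_integral ?c * ?M) {0..1}" by (simp only:)
  have le: "\<bar>?f x - ?g x\<bar> \<le> ?b x" if "x \<in> {0..1} - ?A" for x
    using truncation_error[OF N] sin_multiple_nonzero[OF n that]
    by (simp only: log_two_sin_trunc_eq_max not_False_eq_True)
  have "?I - ?J \<le> ?c * ?M"
    by (rule has_integral_le_off_negligible[OF has_integral_diff[OF f g] b neg]) (use le in force)
  moreover have "?J - ?I \<le> ?c * ?M"
    by (rule has_integral_le_off_negligible[OF has_integral_diff[OF g f] b neg]) (use le in force)
  ultimately show ?thesis by linarith
qed

lemma log_two_sin_diff_tendsto_0:
  assumes "odd k"
  shows "(\<lambda>n. integral {0..1} (\<lambda>x. (log_two_sin (real n * x) - log_two_sin x) ^ k)) \<longlonglongrightarrow> 0"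
proof (rule LIMSEQ_I)
  fix r :: real assume r: "r > 0"
  let ?M = "integral {0..1} (\<lambda>x. \<bar>log_two_sin x\<bar> ^ Suc k)"
  let ?I = "\<lambda>n. integral {0..1} (\<lambda>x. (log_two_sin (real n * x) - log_two_sin x) ^ k)"
  have M: "?M \<ge> 0" by (intro integral_nonneg log_two_sin_power_integrable) auto
  \<comment> \<open>\<open>N\<close> is fixed before \<open>n\<close>: it pushes the truncation
    error below \<open>r / 2\<close>, and the added 1 keeps it positive and the estimate strict even
    if \<open>?M = 0\<close>.\<close>
  define N where "N = 2 ^ (k + 3) * ?M * 2 / r + 1"
  have N: "N > 0" using M r by (simp add: N_def add_nonneg_pos)
  have "2 ^ (k + 3) * ?M < N * (r / 2)"
    using r by (simp add: N_def field_simps)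
  then have small: "2 ^ (k + 3) / N * ?M < r / 2"
    using N by (simp add: field_simps)
  let ?J = "\<lambda>n. integral {0..1} (\<lambda>x. (log_two_sin_trunc N (real n * x) - log_two_sin_trunc N x) ^ k)"
  have "?J \<longlonglongrightarrow> 0"
  proof (rule integral_diagonal_tendsto_0[where H = "\<lambda>x y. (log_two_sin_trunc N x - log_two_sin_trunc N y) ^ k"])
    show "continuous_on UNIV (\<lambda>(x, y). (log_two_sin_trunc N x - log_two_sin_trunc N y) ^ k)"
      unfolding case_prod_unfold
      by (intro continuous_intros continuous_on_compose2[OF continuous_on_log_two_sin_trunc[OF continuous_on_id]]) auto
    \<comment> \<open>The parity of \<open>k\<close> enters here.\<close>
    show "(log_two_sin_trunc N x - log_two_sin_trunc N y) ^ k
        = - ((log_two_sin_trunc N y - log_two_sin_trunc N x) ^ k)" for x y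
      using assms by (simp flip: power_minus_odd)
  qed (simp add: log_two_sin_trunc_add_int)
  then obtain n0 where n0: "\<And>n. n \<ge> n0 \<Longrightarrow> \<bar>?J n\<bar> < r / 2"
    using LIMSEQ_D[of ?J 0 "r / 2"] r by auto
  have "norm (?I n - 0) < r" if "n \<ge> max n0 1" for n
  proof -
    have "\<bar>?J n\<bar> < r / 2" "\<bar>?I n - ?J n\<bar> < r / 2"
      using n0[of n] log_two_sin_diff_truncation[OF _ N, of n k] small that by linarith+
    then show ?thesis unfolding real_norm_def by linarith
  qed
  then show "\<exists>no. \<forall>n\<ge>no. norm (?I n - 0) < r" by blast
qed

section \<open>Negativity at \<open>n = 2\<close>\<close>

text \<open>The large negative values of \<open>ln \<bar>2 * cos (pi * x)\<bar>\<close> near \<open>x = 1/2\<close> outweigh all positive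
  ones: it is at most \<open>-3\<close> on an interval of length \<open>1/70\<close> and less than \<open>7/10\<close> everywhere.\<close>

lemma log_two_sin_diff_2_neg:
  assumes k: "odd k" "k \<ge> 3"
  shows "integral {0..1} (\<lambda>x. (log_two_sin (real 2 * x) - log_two_sin x) ^ k) < 0" (is "?I < 0")
proof -
  let ?A = "(\<lambda>i. real i / real 2) ` {..2}"
  let ?D = "{1/2 - 1/140 .. 1/2 + 1/140 :: real}"
  let ?f = "\<lambda>x. (log_two_sin (real 2 * x) - log_two_sin x) ^ k"
  \<comment> \<open>A step function above \<open>?f\<close>: the interval \<open>?D\<close> has
    length \<open>1/70\<close>, so \<open>?b\<close> integrates to
    \<open>(7/10) ^ k - 3 ^ k / 70\<close>.\<close>
  let ?b = "\<lambda>x. (7/10) ^ k - (if x \<in> ?D then 3 ^ k else 0 :: real)"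
  have neg: "negligible ?A" by (intro negligible_finite) auto
  have f: "(?f has_integral ?I) {0..1}"
    using set_lebesgue_integral_eq_integral(1)[OF log_two_sin_diff_integrable[of 2 k]]
    by (simp add: has_integral_integral)
  have "((\<lambda>x. 3 ^ k :: real) has_integral 3 ^ k / 70) ?D"
    using has_integral_const_real[of "3 ^ k :: real" "1/2 - 1/140" "1/2 + 1/140"] by simp
  then have D: "((\<lambda>x. if x \<in> ?D then 3 ^ k else 0 :: real) has_integral 3 ^ k / 70) {0..1}"
    by (subst has_integral_restrict) auto
  have c: "((\<lambda>x::real. (7/10) ^ k :: real) has_integral (7/10) ^ k) {0..1}"
    using has_integral_const_real[of "(7/10) ^ k :: real" 0 1] by simp
  have b: "(?b has_integral (7/10) ^ k - 3 ^ k / 70) {0..1}"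
    by (rule has_integral_diff[OF c D])
  have "?f x \<le> ?b x" if x: "x \<in> {0..1} - ?A" for x
  proof -
    note nz = sin_multiple_nonzero[OF _ x, simplified]
    \<comment> \<open>Doubling the angle turns the difference into
      \<open>z = ln \<bar>2 * cos (pi * x)\<bar>\<close>.\<close>
    have s2: "sin (pi * (2 * x)) = 2 * sin (pi * x) * cos (pi * x)"
      using sin_double[of "pi * x"] by (simp add: mult_ac)
    have cnz: "cos (pi * x) \<noteq> 0" using nz s2 by auto
    define z where "z = ln \<bar>2 * cos (pi * x)\<bar>"
    have "\<bar>2 * sin (pi * (2 * x))\<bar> = \<bar>2 * sin (pi * x)\<bar> * \<bar>2 * cos (pi * x)\<bar>"
      by (simp add: s2 abs_mult)
    then have "log_two_sin (2 * x) = log_two_sin x + z"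
      unfolding log_two_sin_def z_def using nz cnz by (simp only: ln_mult) (simp add: ln_mult)
    then have fz: "?f x = z ^ k" by simp
    show ?thesis
    proof (cases "x \<in> ?D")
      case False
      have "z \<le> ln 2" unfolding z_def using cnz by (subst ln_le_cancel_iff) (auto simp: abs_mult)
      also have "ln 2 \<le> (7/10 :: real)" using ln2_le_25_over_36 by simp
      finally have "z ^ k \<le> (7/10) ^ k" by (rule power_mono_odd[OF k(1)])
      then show ?thesis unfolding fz if_not_P[OF False] by simp
    next
      case True
      have "cos (pi * x) = sin (pi * (1/2 - x))"
        by (simp add: right_diff_distrib sin_diff)
      then have c0: "\<bar>cos (pi * x)\<bar> \<le> \<bar>pi * (1/2 - x)\<bar>" by (simp only: abs_sin_x_le_abs_x)
      have "\<bar>1/2 - x\<bar> \<le> 1/140" using True unfolding atLeastAtMost_iff by linarith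
      \<comment> \<open>The half-width \<open>1/140\<close> gives
        \<open>2 * 3.15 / 140 = 9/200\<close>, which lies below \<open>exp (-3)\<close>.\<close>
      then have "\<bar>pi * (1/2 - x)\<bar> \<le> 3.15 * (1/140)"
        unfolding abs_mult using pi_approx by (intro mult_mono) auto
      with c0 have c1: "\<bar>2 * cos (pi * x)\<bar> \<le> 9/200" by simp
      have "exp (3::real) = exp 1 ^ 3" by (simp flip: exp_of_nat_mult)
      also have "\<dots> \<le> (272/100) ^ 3" using e_less_272 by (intro power_mono) auto
      also have "\<dots> \<le> 200/9" by (simp add: eval_nat_numeral)
      finally have "9/200 \<le> exp (-3::real)" by (simp add: exp_minus field_simps)
      with c1 have "z \<le> ln (exp (-3))" unfolding z_def using cnz by (subst ln_le_cancel_iff) auto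
      then have "z ^ k \<le> (-3) ^ k" by (intro power_mono_odd[OF k(1)]) simp
      also have "\<dots> = - (3 ^ k)" using k(1) by simp
      also have "\<dots> \<le> ?b x" unfolding if_P[OF True] by simp
      finally show ?thesis unfolding fz .
    qed
  qed
  then have "?I \<le> (7/10) ^ k - 3 ^ k / 70"
    by (rule has_integral_le_off_negligible[OF f b neg])
  \<comment> \<open>Both terms are monotone in \<open>k\<close>, so \<open>k = 3\<close> is the
    worst case, where \<open>0.343 < 27/70\<close>.\<close>
  also have "(7/10 :: real) ^ k \<le> (7/10) ^ 3"
    using k(2) by (intro power_decreasing) auto
  also have "(7/10 :: real) ^ 3 - 3 ^ k / 70 \<le> (7/10) ^ 3 - 3 ^ 3 / 70"
    using power_increasing[OF k(2), of "3::real"] by simp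
  also have "\<dots> < 0" by (simp add: eval_nat_numeral)
  finally show ?thesis by simp
qed

theorem theorem5:
  fixes h :: nat
  assumes "h \<ge> 1"
  shows "(\<lambda>n. mahler_k (2 * h + 1) (P_poly n)) \<longlonglongrightarrow> 0
       \<and> \<not> (\<exists>c. \<forall>n\<ge>1. mahler_k (2 * h + 1) (P_poly n) = c)"
proof
  let ?k = "2 * h + 1"
  \<comment> \<open>The integral formula is available from \<open>n = 1\<close> on, which suffices
    for the limit.\<close>
  have "eventually (\<lambda>n. integral {0..1} (\<lambda>x. (log_two_sin (real n * x) - log_two_sin x) ^ ?k)
      = mahler_k ?k (P_poly n)) sequentially"
    using eventually_ge_at_top[of 1] by eventually_elim (rule mahler_P_poly[symmetric])
  then show "(\<lambda>n. mahler_k ?k (P_poly n)) \<longlonglongrightarrow> 0"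
    by (rule Lim_transform_eventually[OF log_two_sin_diff_tendsto_0, rotated]) simp
  have "mahler_k ?k (P_poly 1) = 0"
    by (subst mahler_P_poly) auto
  moreover have "mahler_k ?k (P_poly 2) < 0"
    using assms mahler_P_poly[of 2 ?k] log_two_sin_diff_2_neg[of ?k] by simp
  ultimately show "\<not> (\<exists>c. \<forall>n\<ge>1. mahler_k ?k (P_poly n) = c)"
    by (metis less_irrefl one_le_numeral order_refl)
qed

end
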